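(* Let $d\ge 1$ and let $f\in\mathcal{M}(\mathbb{B}_d)_1$ be a non-constant function admitting a unitary realization $$f(z)=A+B\Bigl(I-\sum_{j=1}^d z_jD_j\Bigr)^{-1}\Bigl(\sum_{j=1}^d z_jC_j\Bigr)\qquad\text{for all } z=(z_1,\dots,z_d)\in\mathbb{B}_d,$$ where $\mathcal{H}$ is a Hilbert space and $$V=\begin{bmatrix}A&B\\ C&D\end{bmatrix}=\begin{bmatrix}A&B\\ C_1&D_1\\ \vdots&\vdots\\ C_d&D_d\end{bmatrix}:\begin{bmatrix}\mathbb{C}\\ \mathcal{H}\end{bmatrix}\to\begin{bmatrix}\mathbb{C}\\ \mathcal{H}\otimes\mathbb{C}^d\end{bmatrix}$$ is a unitary operator. Let $D^*=[D_1^*\ \cdots\ D_d^*]:\mathcal{H}\otimes\mathbb{C}^d\to\mathcal{H}$ be the associated row operator. Then $$\mathcal{Z}_{\mathbb{B}_d}(f)=\sigma_p^{\mathrm{row}}(D^* )\cap\mathbb{B}_d .$$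
   Context: $\mathbb{B}_d=\{z\in\mathbb{C}^d:\sum_{j=1}^d|z_j|^2<1\}$. The Drury--Arveson space $\mathcal{H}^2_d$ is the reproducing kernel Hilbert space of holomorphic functions on $\mathbb{B}_d$ with kernel $K(z,w)=\frac{1}{1-\langle z,w\rangle_{\mathbb{C}^d}}$. Its multiplier algebra is $\mathcal{M}(\mathbb{B}_d)=\{\varphi:\mathbb{B}_d\to\mathbb{C}:\ \varphi g\in\mathcal{H}^2_d\text{ for all }g\in\mathcal{H}^2_d\}$ with norm $\|\varphi\|_{\mathcal{M}}=\|M_\varphi\|_{\mathcal{B}(\mathcal{H}^2_d)}$, $M_\varphi g=\varphi g$. $\mathcal{M}(\mathbb{B}_d)_1$ denotes its (closed) unit ball. $\mathcal{Z}_{\mathbb{B}_d}(f)=\{\lambda\in\mathbb{B}_d:f(\lambda)=0\}$. Row eigenvalues: for a row operator $T=[T_1\ \cdots\ T_d]:\mathcal{H}\otimes\mathbb{C}^d\to\mathcal{H}$ (acting by $T[v_1\ \cdots\ v_d]^t=\sum_jT_jv_j$), a point $\lambda=(\lambda_1,\dots,\lambda_d)\in\mathbb{C}^d$ is a row eigenvalue of $T$ if there is a non-zero $v=[v_1\ \cdots\ v_d]^t\in\mathcal{H}\otimes\mathbb{C}^d$ with $Tv=\sum_{j=1}^d\lambda_jv_j$. $\sigma_p^{\mathrm{row}}(T)$ is the set of all row eigenvalues of $T$. *)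

theory Defs
  imports "HOL-Analysis.Analysis"
begin

section \<open>Complex Hilbert spaces\<close>

class complex_vector = real_vector +
  fixes scaleC :: "complex \<Rightarrow> 'a \<Rightarrow> 'a" (infixr "*\<^sub>C" 75)
  assumes scaleC_add_right: "a *\<^sub>C (x + y) = a *\<^sub>C x + a *\<^sub>C y"
    and scaleC_add_left: "(a + b) *\<^sub>C x = a *\<^sub>C x + b *\<^sub>C x"
    and scaleC_scaleC: "a *\<^sub>C b *\<^sub>C x = (a * b) *\<^sub>C x"
    and scaleR_scaleC: "r *\<^sub>R x = complex_of_real r *\<^sub>C x"

text \<open>Inner products are linear in the first argument. Positive definiteness and the
  relation to the norm are inherited from the real inner product.\<close>

class complex_inner = complex_vector + real_inner +
  fixes cinner :: "'a \<Rightarrow> 'a \<Rightarrow> complex"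
  assumes cinner_commute: "cinner x y = cnj (cinner y x)"
    and cinner_add_left: "cinner (x + y) z = cinner x z + cinner y z"
    and cinner_scaleC_left: "cinner (a *\<^sub>C x) y = a * cinner x y"
    and Re_cinner: "Re (cinner x y) = inner x y"

class chilbert_space = complex_inner + complete_space

instantiation complex :: chilbert_space
begin

definition scaleC_complex :: "complex \<Rightarrow> complex \<Rightarrow> complex" where
  "scaleC_complex a x = a * x"

definition cinner_complex :: "complex \<Rightarrow> complex \<Rightarrow> complex" where
  "cinner_complex x y = x * cnj y"

instance
  by standard
    (simp_all add: scaleC_complex_def cinner_complex_def algebra_simps inner_complex_def
      scaleR_conv_of_real)

end

instantiation prod :: (chilbert_space, chilbert_space) chilbert_space
begin

definition scaleC_prod :: "complex \<Rightarrow> 'a \<times> 'b \<Rightarrow> 'a \<times> 'b" where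
  "scaleC_prod a x = (a *\<^sub>C fst x, a *\<^sub>C snd x)"

definition cinner_prod :: "'a \<times> 'b \<Rightarrow> 'a \<times> 'b \<Rightarrow> complex" where
  "cinner_prod x y = cinner (fst x) (fst y) + cinner (snd x) (snd y)"

instance
proof
  fix x y :: "'a \<times> 'b"
  show "cinner x y = cnj (cinner y x)"
    unfolding cinner_prod_def complex_cnj_add by (metis cinner_commute)
qed (simp_all add: scaleC_prod_def cinner_prod_def scaleC_add_right scaleC_add_left
    scaleC_scaleC scaleR_scaleC[symmetric] scaleR_prod_def cinner_add_left cinner_scaleC_left
    Re_cinner inner_prod_def algebra_simps)

end

text \<open>The Hilbert space tensor product of a Hilbert space \<open>'a\<close> with $\mathbb{C}^d$ is
  \<open>'a ^ 'd\<close>; in particular \<open>complex ^ 'd\<close> is $\mathbb{C}^d$ itself.\<close>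

instantiation vec :: (chilbert_space, finite) chilbert_space
begin

definition scaleC_vec :: "complex \<Rightarrow> 'a ^ 'b \<Rightarrow> 'a ^ 'b" where
  "scaleC_vec a x = (\<chi> j. a *\<^sub>C (x $ j))"

definition cinner_vec :: "'a ^ 'b \<Rightarrow> 'a ^ 'b \<Rightarrow> complex" where
  "cinner_vec x y = (\<Sum>j\<in>UNIV. cinner (x $ j) (y $ j))"

instance
proof
  fix x y :: "'a ^ 'b"
  show "cinner x y = cnj (cinner y x)"
    unfolding cinner_vec_def cnj_sum by (metis cinner_commute)
qed (simp_all add: scaleC_vec_def cinner_vec_def scaleC_add_right scaleC_add_left
    scaleC_scaleC scaleR_scaleC[symmetric] cinner_add_left cinner_scaleC_left
    Re_cinner inner_vec_def vec_eq_iff sum.distrib sum_distrib_left)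

end

definition bounded_clinear :: "('a::chilbert_space \<Rightarrow> 'b::chilbert_space) \<Rightarrow> bool" where
  "bounded_clinear T \<longleftrightarrow> bounded_linear T \<and> (\<forall>c x. T (c *\<^sub>C x) = c *\<^sub>C T x)"

definition cadjoint :: "('a::chilbert_space \<Rightarrow> 'b::chilbert_space) \<Rightarrow> 'b \<Rightarrow> 'a" where
  "cadjoint T = (SOME S. \<forall>x y. cinner (T x) y = cinner x (S y))"

definition unitary_operator :: "('a::chilbert_space \<Rightarrow> 'b::chilbert_space) \<Rightarrow> bool" where
  "unitary_operator U \<longleftrightarrow>
    bounded_clinear U \<and> surj U \<and> (\<forall>x y. cinner (U x) (U y) = cinner x y)"


section \<open>Reproducing kernel Hilbert spaces\<close>

text \<open>A function on a set \<open>X\<close> is represented by its extension by zero to the whole type, so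
  that equality of functions on \<open>X\<close> is equality in HOL.\<close>

locale hilbert_function_space =
  fixes X :: "'x set"
    and F :: "('x \<Rightarrow> complex) set"
    and ip :: "('x \<Rightarrow> complex) \<Rightarrow> ('x \<Rightarrow> complex) \<Rightarrow> complex"
  assumes vanishes_outside: "\<lbrakk>g \<in> F; z \<notin> X\<rbrakk> \<Longrightarrow> g z = 0"
    and zero_mem: "(\<lambda>z. 0) \<in> F"
    and add_mem: "\<lbrakk>g \<in> F; h \<in> F\<rbrakk> \<Longrightarrow> (\<lambda>z. g z + h z) \<in> F"
    and scale_mem: "g \<in> F \<Longrightarrow> (\<lambda>z. c * g z) \<in> F"
    and ip_commute: "\<lbrakk>g \<in> F; h \<in> F\<rbrakk> \<Longrightarrow> ip g h = cnj (ip h g)"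
    and ip_add_left:
      "\<lbrakk>g \<in> F; h \<in> F; k \<in> F\<rbrakk> \<Longrightarrow> ip (\<lambda>z. g z + h z) k = ip g k + ip h k"
    and ip_scale_left: "\<lbrakk>g \<in> F; h \<in> F\<rbrakk> \<Longrightarrow> ip (\<lambda>z. c * g z) h = c * ip g h"
    and ip_pos: "\<lbrakk>g \<in> F; g \<noteq> (\<lambda>z. 0)\<rbrakk> \<Longrightarrow> 0 < Re (ip g g)"
    and complete:
      "\<lbrakk>\<And>n. s n \<in> F;
        \<forall>e>0. \<exists>N. \<forall>m\<ge>N. \<forall>n\<ge>N.
          sqrt (Re (ip (\<lambda>z. s m z - s n z) (\<lambda>z. s m z - s n z))) < e\<rbrakk>
       \<Longrightarrow> \<exists>g\<in>F. (\<lambda>n. sqrt (Re (ip (\<lambda>z. s n z - g z) (\<lambda>z. s n z - g z)))) \<longlonglongrightarrow> 0"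

locale rkhs = hilbert_function_space X F ip
  for X :: "'x set" and F and ip +
  fixes K :: "'x \<Rightarrow> 'x \<Rightarrow> complex"
  assumes kernel_mem: "w \<in> X \<Longrightarrow> (\<lambda>z. if z \<in> X then K z w else 0) \<in> F"
    and reproducing: "\<lbrakk>w \<in> X; g \<in> F\<rbrakk> \<Longrightarrow> g w = ip g (\<lambda>z. if z \<in> X then K z w else 0)"


section \<open>The Drury--Arveson space and its multipliers\<close>

definition unit_ball :: "(complex ^ 'd) set" where
  "unit_ball = {z. (\<Sum>j\<in>UNIV. (cmod (z $ j))\<^sup>2) < 1}"

definition holomorphic_on_ball :: "(complex ^ 'd \<Rightarrow> complex) \<Rightarrow> bool" where
  "holomorphic_on_ball g \<longleftrightarrow>
    (\<forall>z\<in>unit_ball. \<exists>L. bounded_clinear L \<and> (g has_derivative L) (at z))"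

definition da_kernel :: "complex ^ 'd \<Rightarrow> complex ^ 'd \<Rightarrow> complex" where
  "da_kernel z w = 1 / (1 - cinner z w)"

text \<open>A kernel determines its space \<open>F\<close> and the inner product \<open>ip\<close> on \<open>F \<times> F\<close>; the choice
  operator only fixes the irrelevant values of \<open>ip\<close> elsewhere.\<close>

definition drury_arveson ::
  "(complex ^ 'd \<Rightarrow> complex) set \<times>
    ((complex ^ 'd \<Rightarrow> complex) \<Rightarrow> (complex ^ 'd \<Rightarrow> complex) \<Rightarrow> complex)" where
  "drury_arveson =
    (SOME (F, ip). rkhs unit_ball F ip da_kernel \<and> (\<forall>g\<in>F. holomorphic_on_ball g))"

definition da_space :: "(complex ^ 'd \<Rightarrow> complex) set" where
  "da_space = fst drury_arveson"

definition da_norm :: "(complex ^ 'd \<Rightarrow> complex) \<Rightarrow> real" where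
  "da_norm g = sqrt (Re (snd drury_arveson g g))"

text \<open>The values of a multiplier outside the ball play no role, because the elements of
  \<^const>\<open>da_space\<close> vanish there.\<close>

definition da_multipliers :: "(complex ^ 'd \<Rightarrow> complex) set" where
  "da_multipliers = {\<phi>. \<forall>g\<in>da_space. (\<lambda>z. \<phi> z * g z) \<in> da_space}"

definition multiplier_norm :: "(complex ^ 'd \<Rightarrow> complex) \<Rightarrow> real" where
  "multiplier_norm \<phi> =
    (SUP g\<in>{g \<in> da_space. da_norm g \<le> 1}. da_norm (\<lambda>z. \<phi> z * g z))"

definition multiplier_unit_ball :: "(complex ^ 'd \<Rightarrow> complex) set" where
  "multiplier_unit_ball = {\<phi> \<in> da_multipliers. multiplier_norm \<phi> \<le> 1}"

definition ball_zeros :: "(complex ^ 'd \<Rightarrow> complex) \<Rightarrow> (complex ^ 'd) set" where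
  "ball_zeros f = {z \<in> unit_ball. f z = 0}"


section \<open>Row operators and realizations\<close>

definition row_operator ::
  "('d \<Rightarrow> 'h \<Rightarrow> 'h) \<Rightarrow> 'h ^ 'd \<Rightarrow> 'h::chilbert_space" where
  "row_operator T v = (\<Sum>j\<in>UNIV. T j (v $ j))"

definition row_eigenvalues ::
  "('h ^ 'd \<Rightarrow> 'h::chilbert_space) \<Rightarrow> (complex ^ 'd) set" where
  "row_eigenvalues T = {z. \<exists>v. v \<noteq> 0 \<and> T v = (\<Sum>j\<in>UNIV. z $ j *\<^sub>C v $ j)}"

definition block_operator ::
  "(complex \<Rightarrow> complex) \<Rightarrow> ('h \<Rightarrow> complex) \<Rightarrow> ('d \<Rightarrow> complex \<Rightarrow> 'h) \<Rightarrow> ('d \<Rightarrow> 'h \<Rightarrow> 'h)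
    \<Rightarrow> complex \<times> 'h \<Rightarrow> complex \<times> ('h::chilbert_space ^ 'd)" where
  "block_operator A B C D = (\<lambda>(c, h). (A c + B h, \<chi> j. C j c + D j h))"

text \<open>Operators from $\mathbb{C}$ are identified with vectors through their value at \<open>1\<close>. For a
  contractive column \<open>D\<close> and \<open>z\<close> in the ball, the map inverted here is bijective.\<close>

definition realization ::
  "(complex \<Rightarrow> complex) \<Rightarrow> ('h \<Rightarrow> complex) \<Rightarrow> ('d \<Rightarrow> complex \<Rightarrow> 'h) \<Rightarrow> ('d \<Rightarrow> 'h \<Rightarrow> 'h::chilbert_space)
    \<Rightarrow> complex ^ 'd \<Rightarrow> complex" where
  "realization A B C D z =
    A 1 + B (inv (\<lambda>h. h - (\<Sum>j\<in>UNIV. z $ j *\<^sub>C D j h)) (\<Sum>j\<in>UNIV. z $ j *\<^sub>C C j 1))"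

definition unitary_realization ::
  "(complex \<Rightarrow> complex) \<Rightarrow> ('h \<Rightarrow> complex) \<Rightarrow> ('d \<Rightarrow> complex \<Rightarrow> 'h) \<Rightarrow> ('d \<Rightarrow> 'h \<Rightarrow> 'h::chilbert_space)
    \<Rightarrow> (complex ^ 'd \<Rightarrow> complex) \<Rightarrow> bool" where
  "unitary_realization A B C D f \<longleftrightarrow>
    bounded_clinear A \<and> bounded_clinear B \<and>
    (\<forall>j. bounded_clinear (C j)) \<and> (\<forall>j. bounded_clinear (D j)) \<and>
    unitary_operator (block_operator A B C D) \<and>
    (\<forall>z\<in>unit_ball. f z = realization A B C D z)"

end

theory Submission
  imports Defs
begin

text \<open>
  Write \<open>V\<close> for the unitary block operator and, for a point \<open>z\<close> of the ball,
  \<open>Z v = (\<Sum>j. z\<^sub>j v\<^sub>j)\<close>; by Cauchy--Schwarz, \<open>\<parallel>Z\<parallel> \<le> \<parallel>z\<parallel> < 1\<close>. Eliminating \<open>x\<close> from the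
  system \<open>V (c, x) = (a, v)\<close>, \<open>x = Z v\<close> gives \<open>x = c (I - Z D)\<inverse> Z C 1\<close> and then
  \<open>a = c f(z)\<close>: the realization formula says that \<open>V\<close> with the feedback \<open>x = Z v\<close> sends the
  input \<open>c\<close> to the output \<open>c f(z)\<close> (\<open>feedback_output\<close>, \<open>feedback_solvable\<close>).

  The adjoint row is a corner of \<open>V\<^sup>* = V\<inverse>\<close>, so \<open>D\<^sup>* v = Z v\<close> means that
  \<open>V\<inverse> (0, v) = (c, Z v)\<close> for some scalar \<open>c\<close> (\<open>row_eigenvalue_iff_feedback\<close>). Hence a row
  eigenvalue is a point at which the feedback system has a non-zero solution with output \<open>0\<close>.
  The input \<open>c\<close> of such a solution cannot vanish, since \<open>V\<close> is isometric and
  \<open>\<parallel>Z v\<parallel> < \<parallel>v\<parallel>\<close>; therefore \<open>c f(z) = 0\<close> forces \<open>f(z) = 0\<close>. Conversely, if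
  \<open>f(z) = 0\<close>, the solution with input \<open>1\<close> has output \<open>0\<close>, and \<open>v \<noteq> 0\<close> because \<open>V\<close>
  is injective (\<open>row_eigenvalue_iff_realization_zero\<close>).
\<close>

section \<open>Complex inner product spaces\<close>

lemma norm_scaleC: "norm (a *\<^sub>C x) = cmod a * norm (x::'a::complex_inner)"
proof -
  have "cinner x (a *\<^sub>C x) = cnj a * cinner x x"
    by (metis cinner_commute cinner_scaleC_left complex_cnj_mult)
  then have "cinner (a *\<^sub>C x) (a *\<^sub>C x) = (a * cnj a) * cinner x x"
    by (simp add: cinner_scaleC_left)
  then have "inner (a *\<^sub>C x) (a *\<^sub>C x) = (cmod a)\<^sup>2 * inner x x"
    by (simp add: Re_cinner[symmetric] complex_norm_square[symmetric])
  then have "(norm (a *\<^sub>C x))\<^sup>2 = (cmod a * norm x)\<^sup>2"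
    by (simp add: power2_norm_eq_inner power_mult_distrib)
  then show ?thesis
    by (simp add: power2_eq_iff_nonneg)
qed

lemma scaleC_zero_right [simp]: "a *\<^sub>C 0 = (0::'a::complex_inner)"
  using norm_scaleC[of a "0::'a"] by simp

lemma scaleC_one [simp]: "1 *\<^sub>C x = (x::'a::complex_vector)"
  using scaleR_scaleC[of 1 x] by simp

lemma scaleC_diff_right: "a *\<^sub>C (x - y) = a *\<^sub>C x - a *\<^sub>C (y::'a::complex_vector)"
  using scaleC_add_right[of a "x - y" y] by (simp add: algebra_simps)

lemma scaleC_sum_right:
  "a *\<^sub>C (\<Sum>j\<in>S. g j) = (\<Sum>j\<in>S. a *\<^sub>C (g j :: 'a::complex_inner))"
  by (induction S rule: infinite_finite_induct) (simp_all add: scaleC_add_right)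

lemma cinner_add_right: "cinner x (y + z) = cinner x y + cinner (x::'a::complex_inner) z"
  by (metis cinner_add_left cinner_commute complex_cnj_add)

lemma cinner_zero_left [simp]: "cinner 0 (x::'a::complex_inner) = 0"
  using cinner_add_left[of 0 0 x] by simp

lemma cinner_zero_right [simp]: "cinner (x::'a::complex_inner) 0 = 0"
  using cinner_add_right[of x 0 0] by simp

lemma cinner_sum_right:
  "cinner (x::'a::complex_inner) (\<Sum>j\<in>S. g j) = (\<Sum>j\<in>S. cinner x (g j))"
  by (induction S rule: infinite_finite_induct) (simp_all add: cinner_add_right)

lemma cinner_cancel_left:
  assumes "\<And>h. cinner h x = cinner h (y::'a::complex_inner)"
  shows "x = y"
  using assms by (metis Re_cinner vector_eq_ldot)


section \<open>Unitary operators\<close>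

lemma unitary_operator_norm: "unitary_operator U \<Longrightarrow> norm (U x) = norm x"
  unfolding unitary_operator_def norm_eq_sqrt_inner by (metis Re_cinner)

lemma unitary_operator_bij:
  assumes "unitary_operator U"
  shows "bij U"
proof (rule bijI)
  have lin: "linear U"
    using assms
    by (simp add: unitary_operator_def bounded_clinear_def bounded_linear.linear)
  show "inj U"
  proof (rule injI)
    fix x y assume "U x = U y"
    then have "norm (x - y) = 0"
      using unitary_operator_norm[OF assms, of "x - y"] by (simp add: linear_diff[OF lin])
    then show "x = y" by simp
  qed
  show "surj U"
    using assms by (simp add: unitary_operator_def)
qed

lemma unitary_operator_inv_adjoint:
  assumes "unitary_operator U"
  shows "cinner (U x) y = cinner x (inv U y)"
proof -
  have "U (inv U y) = y"
    using unitary_operator_bij[OF assms] by (simp add: bij_is_surj surj_f_inv_f)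
  then show ?thesis
    using assms unfolding unitary_operator_def by metis
qed


section \<open>The row of coordinates of a point of the ball\<close>

definition point_row :: "complex ^ 'd \<Rightarrow> 'h ^ 'd \<Rightarrow> 'h::chilbert_space" where
  "point_row z v = (\<Sum>j\<in>UNIV. z $ j *\<^sub>C v $ j)"

lemma point_row_diff: "point_row z (u - v) = point_row z u - point_row z v"
  by (simp add: point_row_def scaleC_diff_right sum_subtractf)

lemma norm_point_row_le: "norm (point_row z v) \<le> norm z * norm v"
proof -
  have "norm (point_row z v) \<le> (\<Sum>j\<in>UNIV. \<bar>cmod (z $ j)\<bar> * \<bar>norm (v $ j)\<bar>)"
    unfolding point_row_def by (rule order_trans[OF norm_sum]) (simp add: norm_scaleC)
  also have "\<dots> \<le> norm z * norm v"
    unfolding norm_vec_def by (rule L2_set_mult_ineq)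
  finally show ?thesis .
qed

lemma unit_ball_iff_norm_less_1: "z \<in> unit_ball \<longleftrightarrow> norm z < 1"
  by (simp add: unit_ball_def norm_vec_def L2_set_def)

text \<open>Surjectivity is the Banach fixed point theorem for \<open>h \<mapsto> y + K h\<close>.\<close>

lemma bij_minus_contraction:
  fixes K :: "'h::chilbert_space \<Rightarrow> 'h"
  assumes diff: "\<And>x y. K (x - y) = K x - K y"
    and bound: "\<And>x. norm (K x) \<le> r * norm x"
    and r: "0 \<le> r" "r < 1"
  shows "bij (\<lambda>h. h - K h)"
proof -
  have "\<exists>!h. h - K h = y" for y
  proof -
    have "\<exists>!h. y + K h = h"
      by (rule banach_fix_type[OF r]) (simp add: dist_norm diff[symmetric] bound)
    moreover have "y + K h = h \<longleftrightarrow> h - K h = y" for h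
      unfolding diff_eq_eq by (rule eq_commute)
    ultimately show ?thesis
      by (simp only:)
  qed
  then show ?thesis
    unfolding bij_iff ..
qed


section \<open>Realizations as feedback systems\<close>

context
  fixes A :: "complex \<Rightarrow> complex"
    and B :: "'h::chilbert_space \<Rightarrow> complex"
    and C :: "'d::finite \<Rightarrow> complex \<Rightarrow> 'h"
    and D :: "'d \<Rightarrow> 'h \<Rightarrow> 'h"
  assumes A: "bounded_clinear A" and B: "bounded_clinear B"
    and C: "\<And>j. bounded_clinear (C j)" and D: "\<And>j. bounded_clinear (D j)"
    and V: "unitary_operator (block_operator A B C D)"
begin

lemma block_maps_zero [simp]: "A 0 = 0" "B 0 = 0" "C j 0 = 0" "D j 0 = 0"
  using A B C[of j] D[of j]
  by (simp_all add: bounded_clinear_def bounded_linear.linear linear_0)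

lemma resolvent_bij:
  assumes z: "z \<in> unit_ball"
  shows "bij (\<lambda>h. h - (\<Sum>j\<in>UNIV. z $ j *\<^sub>C D j h))"
proof -
  define K where "K h = point_row z (\<chi> j. D j h)" for h
  have "bij (\<lambda>h. h - K h)"
  proof (rule bij_minus_contraction)
    fix x y
    have "(\<chi> j. D j (x - y)) = (\<chi> j. D j x) - (\<chi> j. D j y)"
      using D by (simp add: vec_eq_iff bounded_clinear_def bounded_linear.linear linear_diff)
    then show "K (x - y) = K x - K y"
      by (simp add: K_def point_row_diff)
    (* The column D is a corner of the isometry V, hence a contraction. *)
    have "norm (\<chi> j. D j x) \<le> norm (block_operator A B C D (0, x))"
      by (simp add: block_operator_def norm_Pair)
    also have "\<dots> = norm x"
      by (simp add: unitary_operator_norm[OF V] norm_Pair)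
    finally show "norm (K x) \<le> norm z * norm x"
      unfolding K_def
      by (meson norm_point_row_le mult_left_mono norm_ge_zero order_trans)
  qed (use z in \<open>simp_all add: unit_ball_iff_norm_less_1\<close>)
  then show ?thesis
    by (simp add: K_def point_row_def)
qed

text \<open>The state \<open>x = Z v\<close> of a solution satisfies \<open>(I - Z D) x = c Z C 1\<close>, so it is
  \<open>c\<close> times the vector to which \<open>B\<close> is applied in the realization formula.\<close>

lemma feedback_output:
  assumes z: "z \<in> unit_ball"
    and sys: "block_operator A B C D (c, point_row z v) = (a, v)"
  shows "a = c * realization A B C D z"
proof -
  let ?T = "\<lambda>h. h - (\<Sum>j\<in>UNIV. z $ j *\<^sub>C D j h)"
  define y where "y = (\<Sum>j\<in>UNIV. z $ j *\<^sub>C C j 1)"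
  define w where "w = inv ?T y"
  define x where "x = point_row z v"
  have Tw: "?T w = y"
    unfolding w_def by (rule surj_f_inv_f[OF bij_is_surj[OF resolvent_bij[OF z]]])
  have hom: "C j c = c *\<^sub>C C j 1" "D j (c *\<^sub>C h) = c *\<^sub>C D j h"
      "A c = c * A 1" "B (c *\<^sub>C h) = c * B h" for j h
    using A B C[of j] D[of j]
    by (simp_all add: bounded_clinear_def scaleC_complex_def) (metis mult.right_neutral)+
  have v: "v = (\<chi> j. C j c + D j x)" and a: "a = A c + B x"
    using sys by (simp_all add: block_operator_def x_def)
  have swap: "z $ j *\<^sub>C c *\<^sub>C u = c *\<^sub>C z $ j *\<^sub>C u" for j and u :: 'h
    by (simp add: scaleC_scaleC mult.commute)
  have "x = point_row z (\<chi> j. C j c + D j x)"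
    using v by (simp add: x_def)
  then have "?T x = (\<Sum>j\<in>UNIV. z $ j *\<^sub>C C j c)"
    by (simp add: point_row_def scaleC_add_right sum.distrib diff_eq_eq)
  also have "\<dots> = c *\<^sub>C y"
    unfolding y_def scaleC_sum_right by (simp only: hom(1) swap)
  also have "\<dots> = ?T (c *\<^sub>C w)"
    by (simp only: Tw[symmetric] scaleC_diff_right scaleC_sum_right hom swap)
  finally have "x = c *\<^sub>C w"
    using resolvent_bij[OF z] by (meson bij_is_inj injD)
  then show ?thesis
    using a by (simp add: realization_def hom(3) hom(4) w_def y_def distrib_left)
qed

lemma feedback_solvable:
  assumes z: "z \<in> unit_ball"
  shows "\<exists>v. block_operator A B C D (1, point_row z v) = (realization A B C D z, v)"
proof -
  let ?T = "\<lambda>h. h - (\<Sum>j\<in>UNIV. z $ j *\<^sub>C D j h)"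
  define x where "x = inv ?T (\<Sum>j\<in>UNIV. z $ j *\<^sub>C C j 1)"
  have "?T x = (\<Sum>j\<in>UNIV. z $ j *\<^sub>C C j 1)"
    unfolding x_def by (rule surj_f_inv_f[OF bij_is_surj[OF resolvent_bij[OF z]]])
  then have "point_row z (\<chi> j. C j 1 + D j x) = x"
    by (simp add: point_row_def scaleC_add_right sum.distrib diff_eq_eq)
  then have "block_operator A B C D (1, point_row z (\<chi> j. C j 1 + D j x)) =
      (realization A B C D z, \<chi> j. C j 1 + D j x)"
    by (simp add: block_operator_def realization_def x_def)
  then show ?thesis ..
qed


section \<open>The adjoint row\<close>

text \<open>The adjoint of \<open>D\<^sub>j\<close> exists because \<open>V\<inverse>\<close> is an adjoint of \<open>V\<close>: restricted to the
  \<open>j\<close>-th summand of \<open>\<H> \<otimes> \<complex>\<^sup>d\<close> and followed by the projection to \<open>\<H>\<close>, it becomes an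
  adjoint of the corner \<open>D\<^sub>j\<close>.\<close>

lemma cinner_cadjoint: "cinner (D j h) y = cinner h (cadjoint (D j) y)"
proof -
  have "cinner (D j h) y = cinner h (snd (inv (block_operator A B C D) (0, axis j y)))" for h y
  proof -
    have "cinner (D j h) y = cinner (block_operator A B C D (0, h)) (0, axis j y)"
      by (simp add: block_operator_def cinner_prod_def cinner_vec_def axis_def if_distrib
          cong: if_cong)
    also have "\<dots> = cinner (0, h) (inv (block_operator A B C D) (0, axis j y))"
      by (rule unitary_operator_inv_adjoint[OF V])
    finally show ?thesis
      by (simp add: cinner_prod_def)
  qed
  then have "\<exists>S. \<forall>x y. cinner (D j x) y = cinner x (S y)"
    by (intro exI[of _ "\<lambda>y. snd (inv (block_operator A B C D) (0, axis j y))"] allI)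
  then show ?thesis
    unfolding cadjoint_def by (rule someI2_ex) blast
qed

lemma adjoint_row_eq:
  "row_operator (\<lambda>j. cadjoint (D j)) v = snd (inv (block_operator A B C D) (0, v))"
proof (rule cinner_cancel_left)
  fix h
  have "cinner h (row_operator (\<lambda>j. cadjoint (D j)) v) = (\<Sum>j\<in>UNIV. cinner (D j h) (v $ j))"
    by (simp add: row_operator_def cinner_sum_right cinner_cadjoint)
  also have "\<dots> = cinner (block_operator A B C D (0, h)) (0, v)"
    by (simp add: block_operator_def cinner_prod_def cinner_vec_def)
  also have "\<dots> = cinner (0, h) (inv (block_operator A B C D) (0, v))"
    by (rule unitary_operator_inv_adjoint[OF V])
  finally show "cinner h (row_operator (\<lambda>j. cadjoint (D j)) v)
      = cinner h (snd (inv (block_operator A B C D) (0, v)))"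
    by (simp add: cinner_prod_def)
qed

text \<open>Since \<open>D\<^sup>* v\<close> is the second component of \<open>V\<inverse> (0, v)\<close>, the scalar \<open>c\<close> below is just its
  first component.\<close>

lemma row_eigenvalue_iff_feedback:
  "z \<in> row_eigenvalues (row_operator (\<lambda>j. cadjoint (D j))) \<longleftrightarrow>
    (\<exists>v c. v \<noteq> 0 \<and> block_operator A B C D (c, point_row z v) = (0, v))"
proof -
  have "snd (inv (block_operator A B C D) (0, v)) = point_row z v \<longleftrightarrow>
      (\<exists>c. block_operator A B C D (c, point_row z v) = (0, v))" for v
    using unitary_operator_bij[OF V]
    by (metis bij_inv_eq_iff prod.collapse snd_conv)
  then show ?thesis
    by (simp add: row_eigenvalues_def adjoint_row_eq point_row_def)
qed

section \<open>Zeros of the realization\<close>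

lemma row_eigenvalue_iff_realization_zero:
  assumes z: "z \<in> unit_ball"
  shows "z \<in> row_eigenvalues (row_operator (\<lambda>j. cadjoint (D j))) \<longleftrightarrow>
    realization A B C D z = 0"
proof
  assume "z \<in> row_eigenvalues (row_operator (\<lambda>j. cadjoint (D j)))"
  then obtain v c where v: "v \<noteq> 0"
    and sys: "block_operator A B C D (c, point_row z v) = (0, v)"
    by (auto simp: row_eigenvalue_iff_feedback)
  have "c \<noteq> 0"
  proof
    assume "c = 0"
    (* Without input, the isometry V would give |v| = |Z v|. *)
    then have "norm v = norm (point_row z v)"
      using unitary_operator_norm[OF V, of "(c, point_row z v)"] unfolding sys
      by (simp add: norm_Pair)
    also have "\<dots> \<le> norm z * norm v"
      by (rule norm_point_row_le)
    also have "\<dots> < norm v"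
      using z v by (simp add: unit_ball_iff_norm_less_1)
    finally show False by simp
  qed
  then show "realization A B C D z = 0"
    using feedback_output[OF z sys] by simp
next
  assume "realization A B C D z = 0"
  then obtain v where sys: "block_operator A B C D (1, point_row z v) = (0, v)"
    using feedback_solvable[OF z] by auto
  (* The isometry V gives |v|^2 = 1 + |Z v|^2. *)
  have "v \<noteq> 0"
    using unitary_operator_norm[OF V, of "(1, point_row z v)"]
    by (auto simp: sys norm_Pair add_nonneg_eq_0_iff)
  then show "z \<in> row_eigenvalues (row_operator (\<lambda>j. cadjoint (D j)))"
    using sys by (auto simp: row_eigenvalue_iff_feedback)
qed

end

theorem theorem1:
  fixes f :: "complex ^ 'd::finite \<Rightarrow> complex"
    and A :: "complex \<Rightarrow> complex"
    and B :: "'h::chilbert_space \<Rightarrow> complex"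
    and C :: "'d \<Rightarrow> complex \<Rightarrow> 'h"
    and D :: "'d \<Rightarrow> 'h \<Rightarrow> 'h"
  assumes "f \<in> multiplier_unit_ball"
    and "\<not> f constant_on unit_ball"
    and "unitary_realization A B C D f"
  shows "ball_zeros f = row_eigenvalues (row_operator (\<lambda>j. cadjoint (D j))) \<inter> unit_ball"
proof -
  have "z \<in> row_eigenvalues (row_operator (\<lambda>j. cadjoint (D j))) \<longleftrightarrow> f z = 0"
    if "z \<in> unit_ball" for z
    using row_eigenvalue_iff_realization_zero[of A B C D z] assms(3) that
    by (simp add: unitary_realization_def)
  then show ?thesis
    by (auto simp: ball_zeros_def)
qed

end
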